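(* Let $\nu\in\mathbb{R}^k$ be such that $A(\nu)$ is stable. Then there exists $\mu\in\mathbb{R}^k$ such that $(\nu,\mu)$ satisfies the Karush-Kuhn-Tucker conditions $$\nabla_\nu\mathcal{L}(\nu,\mu)=0,\qquad \nu\ge 0,\qquad \mu\ge 0,\qquad \nu^T\mu=0,$$ where $\mathcal{L}(\nu,\mu)=f(\nu)-\nu^T\mu$ and $f(\nu)=\mathrm{trace}(Y(\nu))$, if and only if $$h(\nu):=\nu-\max(\nu-\nabla f(\nu),0)=0.$$
   Context: $M,K\in\mathbb{R}^{n\times n}$ are symmetric positive definite, $D_{\mathrm{int}}\in\mathbb{R}^{n\times n}$ is symmetric positive semidefinite with $D_{\mathrm{int}}M^{-1}K=KM^{-1}D_{\mathrm{int}}$, and $D(\nu)=D_{\mathrm{int}}+\sum_{i=1}^k\nu_iD_iD_i^T$ with $D_i\in\mathbb{R}^{n\times r_i}$ given full rank matrices. $\Phi\in\mathbb{R}^{n\times n}$ is a nonsingular matrix with $\Phi^TM\Phi=I_n$, $\Phi^TK\Phi=\Omega^2$, $\Omega=\mathrm{diag}(\omega_1,\dots,\omega_n)$ with all $\omega_i>0$, and $\Phi^TD_{\mathrm{int}}\Phi$ diagonal. Define $$A(\nu)=\begin{bmatrix}0&\Omega\\-\Omega&-\Phi^TD(\nu)\Phi\end{bmatrix}\in\mathbb{R}^{2n\times 2n}.$$ A matrix is called stable if all its eigenvalues have strictly negative real part. For a given integer $s$ with $1\le s\le n$, $Z=\frac{1}{2s}GG^T$, where $$G=\begin{bmatrix}I_s&0\\0&0\\0&I_s\\0&0\end{bmatrix}\in\mathbb{R}^{2n\times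 2s}$$ (block rows of sizes $s,n-s,s,n-s$). When $A(\nu)$ is stable, $Y(\nu)$ denotes the unique solution of the Lyapunov equation $A(\nu)Y(\nu)+Y(\nu)A(\nu)^T=-Z$; the function $f$ is differentiable on the open set of $\nu$ for which $A(\nu)$ is stable. Vector inequalities and the maximum $\max(\cdot,0)$ are taken entrywise. The conditions above are the KKT conditions of the problem of minimizing $\mathrm{trace}(Y(\nu))$ over $\nu\ge 0$ with $A(\nu)$ stable. *)

theory Defs
  imports
    "HOL-Analysis.Analysis"
    "Jordan_Normal_Form.Gauss_Jordan_Elimination"
    "Jordan_Normal_Form.Char_Poly"
    "Jordan_Normal_Form.DL_Rank"
begin

text \<open>
  System matrices are dimension-carrying matrices of Jordan_Normal_Form; the parameter vectors
  live in the Euclidean space \<open>real ^ 'k\<close>. Both libraries use the symbols \<open>$\<close> and \<open>\<bullet>\<close>: below,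
  \<open>$\<close> is the component of a vector in \<open>real ^ 'k\<close> and \<open>\<bullet>\<close> is the Jordan_Normal_Form scalar product.
\<close>

no_notation vec_index (infixl \<open>$\<close> 100)
unbundle no inner_syntax

definition symmetric_mat :: "real mat \<Rightarrow> bool" where
  "symmetric_mat A \<longleftrightarrow> transpose_mat A = A"

definition spd_mat :: "nat \<Rightarrow> real mat \<Rightarrow> bool" where
  "spd_mat n A \<longleftrightarrow> A \<in> carrier_mat n n \<and> symmetric_mat A \<and>
     (\<forall>v \<in> carrier_vec n. v \<noteq> 0\<^sub>v n \<longrightarrow> v \<bullet> (A *\<^sub>v v) > 0)"

definition spsd_mat :: "nat \<Rightarrow> real mat \<Rightarrow> bool" where
  "spsd_mat n A \<longleftrightarrow> A \<in> carrier_mat n n \<and> symmetric_mat A \<and>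
     (\<forall>v \<in> carrier_vec n. v \<bullet> (A *\<^sub>v v) \<ge> 0)"

definition full_rank_mat :: "real mat \<Rightarrow> bool" where
  "full_rank_mat A \<longleftrightarrow> vec_space.rank (dim_row A) A = min (dim_row A) (dim_col A)"

definition mat_trace :: "real mat \<Rightarrow> real" where
  "mat_trace A = (\<Sum>i<dim_row A. A $$ (i, i))"

definition stable_mat :: "real mat \<Rightarrow> bool" where
  "stable_mat A \<longleftrightarrow> (\<forall>z. eigenvalue (map_mat complex_of_real A) z \<longrightarrow> Re z < 0)"

text \<open>
  The sum over \<open>i\<close> is written entrywise, since the matrix type, whose dimensions vary,
  is not an additive monoid.
\<close>

definition damping_mat ::
  "nat \<Rightarrow> real mat \<Rightarrow> ('k::finite \<Rightarrow> real mat) \<Rightarrow> real ^ 'k \<Rightarrow> real mat" where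
  "damping_mat n Dint D \<nu> =
     Dint + mat n n (\<lambda>ab. \<Sum>i\<in>UNIV. \<nu> $ i * (D i * transpose_mat (D i)) $$ ab)"

definition system_mat ::
  "nat \<Rightarrow> real mat \<Rightarrow> (nat \<Rightarrow> real) \<Rightarrow> real mat \<Rightarrow> ('k::finite \<Rightarrow> real mat) \<Rightarrow> real ^ 'k \<Rightarrow> real mat" where
  "system_mat n \<Phi> \<omega> Dint D \<nu> =
     four_block_mat
       (0\<^sub>m n n)           (mat_diag n \<omega>)
       (- mat_diag n \<omega>)  (- (transpose_mat \<Phi> * damping_mat n Dint D \<nu> * \<Phi>))"

definition G_mat :: "nat \<Rightarrow> nat \<Rightarrow> real mat" where
  "G_mat n s = (let E = 1\<^sub>m s @\<^sub>r 0\<^sub>m (n - s) s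
                in four_block_mat E (0\<^sub>m n s) (0\<^sub>m n s) E)"

definition Z_mat :: "nat \<Rightarrow> nat \<Rightarrow> real mat" where
  "Z_mat n s = (1 / (2 * real s)) \<cdot>\<^sub>m (G_mat n s * transpose_mat (G_mat n s))"

text \<open>Meaningful whenever the Lyapunov equation is uniquely solvable, in particular for stable \<open>A\<close>.\<close>

definition lyapunov_sol :: "real mat \<Rightarrow> real mat \<Rightarrow> real mat" where
  "lyapunov_sol A Z =
     (THE Y. Y \<in> carrier_mat (dim_row A) (dim_row A) \<and> A * Y + Y * transpose_mat A = - Z)"

definition objective ::
  "nat \<Rightarrow> nat \<Rightarrow> real mat \<Rightarrow> (nat \<Rightarrow> real) \<Rightarrow> real mat \<Rightarrow> ('k::finite \<Rightarrow> real mat) \<Rightarrow> real ^ 'k \<Rightarrow> real" where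
  "objective n s \<Phi> \<omega> Dint D \<nu> =
     mat_trace (lyapunov_sol (system_mat n \<Phi> \<omega> Dint D \<nu>) (Z_mat n s))"

definition lagrangian :: "(real ^ 'k::finite \<Rightarrow> real) \<Rightarrow> real ^ 'k \<Rightarrow> real ^ 'k \<Rightarrow> real" where
  "lagrangian f \<nu> \<mu> = f \<nu> - inner \<nu> \<mu>"

text \<open>Only meaningful where \<open>f\<close> is differentiable.\<close>

definition gradient :: "('a::real_inner \<Rightarrow> real) \<Rightarrow> 'a \<Rightarrow> 'a" where
  "gradient f x = (THE d. GDERIV f x :> d)"

lemma gradient_eqI:
  assumes "GDERIV f x :> d"
  shows "gradient f x = d"
  unfolding gradient_def
proof (rule the_equality)
  show "GDERIV f x :> d" by (rule assms)
next
  fix e assume "GDERIV f x :> e"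
  with assms have "(\<lambda>h. inner h e) = (\<lambda>h. inner h d)"
    unfolding gderiv_def by (intro has_derivative_unique)
  then have "inner (e - d) e = inner (e - d) d" by (rule fun_cong)
  then have "inner (e - d) (e - d) = 0" by (simp add: inner_diff_right)
  then show "e = d" by simp
qed

text \<open>
  The stationarity condition asserts that the gradient with respect to \<open>\<nu>\<close> exists and vanishes.
  The order on \<open>real ^ 'k\<close> is componentwise.
\<close>

definition KKT :: "(real ^ 'k::finite \<Rightarrow> real) \<Rightarrow> real ^ 'k \<Rightarrow> real ^ 'k \<Rightarrow> bool" where
  "KKT f \<nu> \<mu> \<longleftrightarrow>
     (GDERIV (\<lambda>x. lagrangian f x \<mu>) \<nu> :> 0) \<and> 0 \<le> \<nu> \<and> 0 \<le> \<mu> \<and> inner \<nu> \<mu> = 0"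

definition vmax :: "real ^ 'k::finite \<Rightarrow> real ^ 'k \<Rightarrow> real ^ 'k" where
  "vmax x y = (\<chi> i. max (x $ i) (y $ i))"

definition residual :: "(real ^ 'k::finite \<Rightarrow> real) \<Rightarrow> real ^ 'k \<Rightarrow> real ^ 'k" where
  "residual f \<nu> = \<nu> - vmax (\<nu> - gradient f \<nu>) 0"

end

theory Submission
  imports Defs "Jordan_Normal_Form.Schur_Decomposition"
begin

text \<open>
  Once \<open>f\<close> is differentiable at \<open>\<nu>\<close>, stationarity forces \<open>\<mu> = \<nabla>f(\<nu>)\<close>, and the remaining conditions say
  \<open>min(\<nu>\<^sub>i, \<nabla>f(\<nu>)\<^sub>i) = 0\<close> for each \<open>i\<close>. Differentiability comes from Cramer's rule: the Lyapunov equation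
  is a linear system whose coefficients are affine in \<open>\<nu>\<close>, and its determinant does not vanish
  when \<open>A(\<nu>)\<close> is stable. Indeed \<open>A Y = - Y A\<^sup>T\<close> implies \<open>Y = 0\<close> because \<open>A\<close> and \<open>- A\<^sup>T\<close> have no common
  eigenvalue; in a Schur basis of the right-hand factor, the columns of \<open>Y\<close> vanish one after the
  other, since each would otherwise be an eigenvector of \<open>A\<close> for an eigenvalue of \<open>- A\<^sup>T\<close>.
\<close>

section \<open>Homogeneous Sylvester and Lyapunov equations\<close>

lemma sylvester_trivial_kernel:
  fixes A B X :: "complex mat"
  assumes A: "A \<in> carrier_mat n n" and B: "B \<in> carrier_mat m m" and X: "X \<in> carrier_mat n m"
    and eq: "A * X = X * B"
    and disjoint: "\<And>z. eigenvalue A z \<Longrightarrow> \<not> eigenvalue B z"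
  shows "X = 0\<^sub>m n m"
proof -
  obtain es where es: "char_poly B = (\<Prod>e \<leftarrow> es. [:- e, 1:])" "length es = m"
    using char_poly_factorized[OF B] by blast
  obtain T P Q where "schur_decomposition B es = (T, P, Q)"
    by (cases "schur_decomposition B es") auto
  from schur_decomposition[OF B es(1) this]
  have sim: "similar_mat_wit B T P Q" and upper: "upper_triangular T" and diag: "diag_mat T = es"
    by auto
  from similar_mat_witD2[OF B sim] have PQ: "P * Q = 1\<^sub>m m" and QP: "Q * P = 1\<^sub>m m"
    and BT: "B = P * T * Q" and T: "T \<in> carrier_mat m m" and P: "P \<in> carrier_mat m m"
    and Q: "Q \<in> carrier_mat m m"
    by auto
  \<comment> \<open>The change of basis \<open>P\<close> turns \<open>A * X = X * B\<close> into
    \<open>A * W = W * T\<close> with \<open>T\<close> upper triangular. Column \<open>j\<close> of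
    \<open>W * T\<close> then involves only columns \<open>0\<close> to \<open>j\<close> of
    \<open>W\<close>, which makes induction on \<open>j\<close> possible.\<close>
  define W where "W = X * P"
  have W: "W \<in> carrier_mat n m" using X P by (simp add: W_def)
  have BP: "B * P = P * T"
  proof -
    have "B * P = P * T * (Q * P)"
      unfolding BT using P T Q by (intro assoc_mult_mat) auto
    then show ?thesis using P T by (simp add: QP right_mult_one_mat[of _ m m])
  qed
  have AW: "A * W = W * T"
    using assoc_mult_mat[OF A X P] assoc_mult_mat[OF X B P] assoc_mult_mat[OF X P T] eq BP
    by (simp add: W_def)
  have "col W j = 0\<^sub>v n" if "j < m" for j
    using that
  proof (induction j rule: less_induct)
    case (less j)
    have W0: "W $$ (i, k) = 0" if "i < n" "k < j" for i k
      using less.IH[OF that(2)] that less.prems W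
      by (metis (no_types, lifting) carrier_matD index_col index_zero_vec(1) order.strict_trans)
    have "A *\<^sub>v col W j = col (W * T) j"
      using col_mult2[OF A W less.prems] AW by simp
    also have "\<dots> = T $$ (j, j) \<cdot>\<^sub>v col W j"
    proof (rule eq_vecI)
      fix i assume "i < dim_vec (T $$ (j, j) \<cdot>\<^sub>v col W j)"
      then have i: "i < n" using W by simp
      have "vec_index (col (W * T) j) i = (\<Sum>k\<in>{0..<m}. W $$ (i, k) * T $$ (k, j))"
        using i less.prems W T by (simp add: scalar_prod_def)
      \<comment> \<open>Terms with \<open>k < j\<close> vanish by the induction hypothesis on the
        columns of \<open>W\<close>, terms with \<open>k > j\<close> because \<open>T\<close> is
        upper triangular.\<close>
      also have "\<dots> = (\<Sum>k\<in>{0..<m}. if k = j then W $$ (i, j) * T $$ (j, j) else 0)"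
      proof (rule sum.cong)
        fix k assume "k \<in> {0..<m}"
        then show "W $$ (i, k) * T $$ (k, j) = (if k = j then W $$ (i, j) * T $$ (j, j) else 0)"
          using W0[OF i, of k] upper_triangularD[OF upper, of j k] T
          by (cases k j rule: linorder_cases) auto
      qed simp
      finally show "vec_index (col (W * T) j) i = vec_index (T $$ (j, j) \<cdot>\<^sub>v col W j) i"
        using i less.prems W by simp
    qed (use W T in simp)
    finally have ev: "A *\<^sub>v col W j = T $$ (j, j) \<cdot>\<^sub>v col W j" .
    \<comment> \<open>The diagonal of \<open>T\<close> is the list \<open>es\<close> of roots of the
      characteristic polynomial of \<open>B\<close>, so the factor in \<open>ev\<close> is an
      eigenvalue of \<open>B\<close> and cannot be one of \<open>A\<close>.\<close>
    have "T $$ (j, j) \<in> set es"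
      using diag T less.prems by (auto simp: diag_mat_def)
    then have "eigenvalue B (T $$ (j, j))"
      by (auto simp: eigenvalue_root_char_poly[OF B] es(1) poly_prod_list prod_list_zero_iff)
    then have "\<not> eigenvalue A (T $$ (j, j))"
      using disjoint by blast
    moreover have "col W j \<in> carrier_vec n"
      using W by (intro carrier_vecI) simp
    ultimately show "col W j = 0\<^sub>v n"
      using ev A unfolding eigenvalue_def eigenvector_def by auto
  qed
  then have "W = 0\<^sub>m n m"
    using W by (intro mat_col_eqI) auto
  then have "X * (P * Q) = 0\<^sub>m n m"
    using assoc_mult_mat[OF X P Q] Q by (simp add: W_def)
  then show ?thesis
    using X by (simp add: PQ)
qed

lemma stable_lyapunov_trivial_kernel:
  assumes A: "A \<in> carrier_mat m m" and Y: "Y \<in> carrier_mat m m"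
    and stable: "stable_mat A"
    and eq: "A * Y + Y * transpose_mat A = 0\<^sub>m m m"
  shows "Y = 0\<^sub>m m m"
proof -
  let ?c = "map_mat complex_of_real"
  define B where "B = - transpose_mat (?c A)"
  have cA: "?c A \<in> carrier_mat m m" and cY: "?c Y \<in> carrier_mat m m" and B: "B \<in> carrier_mat m m"
    using A Y by (auto simp: B_def)
  have "A * Y = - (Y * transpose_mat A)"
  proof (rule eq_matI)
    fix i j assume "i < dim_row (- (Y * transpose_mat A))" "j < dim_col (- (Y * transpose_mat A))"
    then show "(A * Y) $$ (i, j) = (- (Y * transpose_mat A)) $$ (i, j)"
      using arg_cong[OF eq, of "\<lambda>M. M $$ (i, j)"] A Y by simp
  qed (use A Y in auto)
  also have "\<dots> = Y * - transpose_mat A"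
    using A Y by simp
  finally have "?c (A * Y) = ?c (Y * - transpose_mat A)" by simp
  also have "?c (Y * - transpose_mat A) = ?c Y * ?c (- transpose_mat A)"
    using A Y by (intro of_real_hom.mat_hom_mult) auto
  also have "?c (- transpose_mat A) = B"
    using A by (auto simp: B_def)
  also have "?c (A * Y) = ?c A * ?c Y"
    by (rule of_real_hom.mat_hom_mult[OF A Y])
  finally have "?c A * ?c Y = ?c Y * B" .
  \<comment> \<open>A common eigenvalue \<open>z\<close> of \<open>A\<close> and \<open>B\<close>
    would make \<open>- z\<close> an eigenvalue of the transpose of \<open>A\<close>, hence of
    \<open>A\<close>, which has the same characteristic polynomial. But \<open>z\<close> and
    \<open>- z\<close> cannot both have negative real part.\<close>
  moreover have "\<not> eigenvalue B z" if z: "eigenvalue (?c A) z" for z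
  proof
    assume "eigenvalue B z"
    then obtain v where v: "v \<in> carrier_vec m" "v \<noteq> 0\<^sub>v m" "B *\<^sub>v v = z \<cdot>\<^sub>v v"
      using B unfolding eigenvalue_def eigenvector_def by auto
    have "- (transpose_mat (?c A) *\<^sub>v v) = z \<cdot>\<^sub>v v"
      using v cA uminus_mult_mat_vec[of v "transpose_mat (?c A)"] by (simp add: B_def)
    then have "transpose_mat (?c A) *\<^sub>v v = - (z \<cdot>\<^sub>v v)"
      by (metis uminus_uminus_vec)
    also have "\<dots> = (- z) \<cdot>\<^sub>v v"
      using v by auto
    finally have "eigenvalue (transpose_mat (?c A)) (- z)"
      using v cA unfolding eigenvalue_def eigenvector_def by auto
    then have "eigenvalue (?c A) (- z)"
      using cA by (simp add: eigenvalue_root_char_poly[of _ m])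
    with z stable have "Re z < 0" "Re (- z) < 0"
      unfolding stable_mat_def by blast+
    then show False by simp
  qed
  ultimately have "?c Y = 0\<^sub>m m m"
    using sylvester_trivial_kernel[OF cA B cY] by blast
  show ?thesis
  proof (rule eq_matI)
    fix i j assume "i < dim_row (0\<^sub>m m m :: real mat)" "j < dim_col (0\<^sub>m m m :: real mat)"
    then show "Y $$ (i, j) = 0\<^sub>m m m $$ (i, j)"
      using arg_cong[OF \<open>?c Y = 0\<^sub>m m m\<close>, of "\<lambda>M. M $$ (i, j)"] Y by simp
  qed (use Y in auto)
qed

section \<open>The Lyapunov equation as a linear system, solved by Cramer's rule\<close>

definition vectorize :: "nat \<Rightarrow> 'a mat \<Rightarrow> 'a vec" where
  "vectorize m Y = vec (m * m) (\<lambda>p. Y $$ (p div m, p mod m))"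

text \<open>The index \<open>j + i * m\<close> is the one with which \<open>sum_mult_product\<close>
  splits a sum over \<open>m * m\<close> indices into a double sum.\<close>

definition unvectorize :: "nat \<Rightarrow> 'a vec \<Rightarrow> 'a mat" where
  "unvectorize m v = mat m m (\<lambda>(i, j). vec_index v (j + i * m))"

text \<open>The Kronecker sum \<open>A \<otimes> I + I \<otimes> A\<close>, which acts on row-major vectorizations.\<close>

definition lyapunov_mat :: "nat \<Rightarrow> 'a::comm_ring_1 mat \<Rightarrow> 'a mat" where
  "lyapunov_mat m A = mat (m * m) (m * m) (\<lambda>(p, q).
     (if p mod m = q mod m then A $$ (p div m, q div m) else 0) +
     (if p div m = q div m then A $$ (p mod m, q mod m) else 0))"

lemma vectorize_carrier [simp]: "vectorize m Y \<in> carrier_vec (m * m)"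
  by (simp add: vectorize_def)

lemma unvectorize_carrier [simp]: "unvectorize m v \<in> carrier_mat m m"
  by (simp add: unvectorize_def)

lemma lyapunov_mat_carrier [simp]: "lyapunov_mat m A \<in> carrier_mat (m * m) (m * m)"
  by (simp add: lyapunov_mat_def)

lemma div_mod_less_square:
  fixes p m :: nat
  assumes "p < m * m"
  shows "p div m < m" "p mod m < m"
  using assms by (auto simp: less_mult_imp_div_less intro!: mod_less_divisor gr0I)

lemma add_mult_less_square:
  fixes i j m :: nat
  assumes "i < m" "j < m"
  shows "j + i * m < m * m"
proof -
  have "j + i * m < Suc i * m" using assms by simp
  also have "\<dots> \<le> m * m" using assms by (intro mult_le_mono1) simp
  finally show ?thesis .
qed

lemma unvectorize_vectorize [simp]:
  assumes "Y \<in> carrier_mat m m"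
  shows "unvectorize m (vectorize m Y) = Y"
  using assms by (intro eq_matI) (auto simp: vectorize_def unvectorize_def add_mult_less_square)

lemma vectorize_unvectorize [simp]:
  assumes "v \<in> carrier_vec (m * m)"
  shows "vectorize m (unvectorize m v) = v"
  using assms
  by (intro eq_vecI) (auto simp: vectorize_def unvectorize_def div_mod_less_square)

lemma lyapunov_mat_mult_vectorize:
  assumes A: "A \<in> carrier_mat m m" and Y: "Y \<in> carrier_mat m m"
  shows "lyapunov_mat m A *\<^sub>v vectorize m Y = vectorize m (A * Y + Y * transpose_mat A)"
proof (rule eq_vecI)
  fix p assume "p < dim_vec (vectorize m (A * Y + Y * transpose_mat A))"
  then have p: "p < m * m" by (simp add: vectorize_def)
  define a b where "a = p div m" and "b = p mod m"
  have ab: "a < m" "b < m" using div_mod_less_square[OF p] by (auto simp: a_def b_def)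
  have dims: "dim_row (lyapunov_mat m A) = m * m" "dim_col (lyapunov_mat m A) = m * m"
    "dim_vec (vectorize m Y) = m * m"
    by (simp_all add: lyapunov_mat_def vectorize_def)
  have "vec_index (lyapunov_mat m A *\<^sub>v vectorize m Y) p =
      (\<Sum>q<m * m. lyapunov_mat m A $$ (p, q) * vec_index (vectorize m Y) q)"
    using p by (simp add: dims scalar_prod_def atLeast0LessThan)
  also have "\<dots> = (\<Sum>q<m * m. ((if b = q mod m then A $$ (a, q div m) else 0) +
         (if a = q div m then A $$ (b, q mod m) else 0)) * Y $$ (q div m, q mod m))"
    using p by (intro sum.cong refl) (simp add: lyapunov_mat_def vectorize_def a_def b_def)
  also have "\<dots> = (\<Sum>i<m. \<Sum>j<m. ((if b = j then A $$ (a, i) else 0) +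
         (if a = i then A $$ (b, j) else 0)) * Y $$ (i, j))"
    unfolding sum_mult_product by (intro sum.cong refl) auto
  \<comment> \<open>Each Kronecker delta removes one summation. The first sum becomes entry
    \<open>(a, b)\<close> of \<open>A * Y\<close>; the second pairs row \<open>b\<close> of
    \<open>A\<close> with row \<open>a\<close> of \<open>Y\<close>, which is entry
    \<open>(a, b)\<close> of \<open>Y * transpose_mat A\<close>.\<close>
  also have "\<dots> = (\<Sum>i<m. \<Sum>j<m. if b = j then A $$ (a, i) * Y $$ (i, b) else 0) +
      (\<Sum>i<m. if a = i then (\<Sum>j<m. A $$ (b, j) * Y $$ (a, j)) else 0)"
  proof -
    have "(\<Sum>j<m. ((if b = j then A $$ (a, i) else 0) +
         (if a = i then A $$ (b, j) else 0)) * Y $$ (i, j)) =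
        (\<Sum>j<m. if b = j then A $$ (a, i) * Y $$ (i, b) else 0) +
        (if a = i then (\<Sum>j<m. A $$ (b, j) * Y $$ (a, j)) else 0)" for i
    proof -
      have "((if b = j then A $$ (a, i) else 0) + (if a = i then A $$ (b, j) else 0)) * Y $$ (i, j) =
          (if b = j then A $$ (a, i) * Y $$ (i, b) else 0) +
          (if a = i then A $$ (b, j) * Y $$ (a, j) else 0)" for j
        by (simp add: distrib_right)
      then show ?thesis
        by (simp only: sum.distrib) simp
    qed
    then show ?thesis
      by (simp only: sum.distrib)
  qed
  also have "\<dots> = (A * Y + Y * transpose_mat A) $$ (a, b)"
    using ab A Y by (simp add: scalar_prod_def atLeast0LessThan mult.commute)
  finally show "vec_index (lyapunov_mat m A *\<^sub>v vectorize m Y) p =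
      vec_index (vectorize m (A * Y + Y * transpose_mat A)) p"
    using p by (simp add: vectorize_def a_def b_def)
qed (simp add: vectorize_def lyapunov_mat_def)

text \<open>A nonzero kernel vector would unvectorize to a nonzero solution of the homogeneous
  Lyapunov equation, which stability excludes.\<close>

lemma det_lyapunov_mat_nonzero:
  assumes A: "A \<in> carrier_mat m m" and "stable_mat A"
  shows "det (lyapunov_mat m A) \<noteq> 0"
proof
  assume "det (lyapunov_mat m A) = 0"
  then obtain v where v: "v \<in> carrier_vec (m * m)" "v \<noteq> 0\<^sub>v (m * m)"
    and "lyapunov_mat m A *\<^sub>v v = 0\<^sub>v (m * m)"
    using det_0_iff_vec_prod_zero_field[OF lyapunov_mat_carrier] by blast
  then have "vectorize m (A * unvectorize m v + unvectorize m v * transpose_mat A) = 0\<^sub>v (m * m)"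
    using lyapunov_mat_mult_vectorize[OF A, of "unvectorize m v"] by simp
  then have "A * unvectorize m v + unvectorize m v * transpose_mat A = unvectorize m (0\<^sub>v (m * m))"
    using A by (metis add_carrier_mat mult_carrier_mat transpose_carrier_mat unvectorize_carrier
        unvectorize_vectorize)
  also have "\<dots> = 0\<^sub>m m m"
    by (auto simp: unvectorize_def add_mult_less_square)
  finally have "unvectorize m v = 0\<^sub>m m m"
    using stable_lyapunov_trivial_kernel[OF A unvectorize_carrier \<open>stable_mat A\<close>] by blast
  then have "v = vectorize m (0\<^sub>m m m)"
    using v by (metis vectorize_unvectorize)
  also have "\<dots> = 0\<^sub>v (m * m)"
    by (auto simp: vectorize_def div_mod_less_square)
  finally show False using v by simp
qed

text \<open>This replaces the definite description by a formula rational in the entries of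
  \<open>A\<close>. It is stated under a determinant condition rather than stability, because that
  condition visibly persists near a given matrix.\<close>

lemma lyapunov_sol_Cramer:
  assumes A: "A \<in> carrier_mat m m" and Z: "Z \<in> carrier_mat m m"
    and det: "det (lyapunov_mat m A) \<noteq> 0"
  shows "lyapunov_sol A Z = unvectorize m
    ((1 / det (lyapunov_mat m A)) \<cdot>\<^sub>v (adj_mat (lyapunov_mat m A) *\<^sub>v vectorize m (- Z)))"
proof -
  let ?S = "lyapunov_mat m A"
  let ?sol = "\<lambda>z. (1 / det ?S) \<cdot>\<^sub>v (adj_mat ?S *\<^sub>v z)"
  note S = lyapunov_mat_carrier[of m A]
  note adj = adj_mat[OF S]
  have scalar: "(c \<cdot>\<^sub>m 1\<^sub>m (m * m)) *\<^sub>v z = c \<cdot>\<^sub>v z"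
    if "z \<in> carrier_vec (m * m)" for c :: real and z
    using that by (intro eq_vecI) auto
  \<comment> \<open>The adjugate is a two-sided inverse up to the factor \<open>det ?S\<close>. The
    identity \<open>right\<close> yields existence of the solution, \<open>left\<close> its
    uniqueness.\<close>
  have right: "?S *\<^sub>v ?sol z = z" if z: "z \<in> carrier_vec (m * m)" for z
  proof -
    have "?S *\<^sub>v ?sol z = (1 / det ?S) \<cdot>\<^sub>v (?S *\<^sub>v (adj_mat ?S *\<^sub>v z))"
      using S mult_mat_vec_carrier[OF adj(1) z] by (rule mult_mat_vec)
    also have "?S *\<^sub>v (adj_mat ?S *\<^sub>v z) = det ?S \<cdot>\<^sub>v z"
      using assoc_mult_mat_vec[OF S adj(1) z] z by (simp add: adj(2) scalar)
    finally show ?thesis using det z by (simp add: smult_smult_assoc)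
  qed
  have left: "?sol (?S *\<^sub>v y) = y" if y: "y \<in> carrier_vec (m * m)" for y
  proof -
    have "adj_mat ?S *\<^sub>v (?S *\<^sub>v y) = det ?S \<cdot>\<^sub>v y"
      using assoc_mult_mat_vec[OF adj(1) S y] y by (simp add: adj(3) scalar)
    then show ?thesis using det y by (simp add: smult_smult_assoc)
  qed
  have sol_carrier: "?sol (vectorize m (- Z)) \<in> carrier_vec (m * m)"
    using mult_mat_vec_carrier[OF adj(1) vectorize_carrier] by simp
  show ?thesis
    unfolding lyapunov_sol_def
  proof (rule the_equality)
    let ?Y = "unvectorize m (?sol (vectorize m (- Z)))"
    have "vectorize m (A * ?Y + ?Y * transpose_mat A) = vectorize m (- Z)"
      unfolding lyapunov_mat_mult_vectorize[OF A unvectorize_carrier, symmetric]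
        vectorize_unvectorize[OF sol_carrier]
      by (rule right) simp
    then have "A * ?Y + ?Y * transpose_mat A = - Z"
      using A Z by (metis add_carrier_mat mult_carrier_mat transpose_carrier_mat
          uminus_carrier_mat unvectorize_carrier unvectorize_vectorize)
    then show "?Y \<in> carrier_mat (dim_row A) (dim_row A) \<and> A * ?Y + ?Y * transpose_mat A = - Z"
      using A by simp
  next
    fix Y assume "Y \<in> carrier_mat (dim_row A) (dim_row A) \<and> A * Y + Y * transpose_mat A = - Z"
    then have Y: "Y \<in> carrier_mat m m" and eq: "A * Y + Y * transpose_mat A = - Z"
      using A by auto
    have "vectorize m Y = ?sol (vectorize m (- Z))"
      using left[of "vectorize m Y"] lyapunov_mat_mult_vectorize[OF A Y] eq by simp
    then show "Y = unvectorize m (?sol (vectorize m (- Z)))"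
      using Y by (metis unvectorize_vectorize)
  qed
qed

section \<open>Differentiability of the trace of the Lyapunov solution\<close>

lemma differentiable_prod:
  fixes f :: "'i \<Rightarrow> 'a::real_normed_vector \<Rightarrow> 'b::real_normed_field"
  assumes "\<And>i. i \<in> I \<Longrightarrow> f i differentiable (at x within S)"
  shows "(\<lambda>y. \<Prod>i\<in>I. f i y) differentiable (at x within S)"
proof -
  from assms obtain f' where "\<And>i. i \<in> I \<Longrightarrow> (f i has_derivative f' i) (at x within S)"
    unfolding differentiable_def by metis
  then show ?thesis
    unfolding differentiable_def by (blast intro: has_derivative_prod)
qed

text \<open>By the Leibniz formula \<open>det_def'\<close>, the determinant is a polynomial in the
  entries.\<close>

lemma differentiable_det:
  fixes S :: "'a::real_normed_vector \<Rightarrow> real mat"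
  assumes S: "\<And>x. S x \<in> carrier_mat n n"
    and diff: "\<And>i j. i < n \<Longrightarrow> j < n \<Longrightarrow> (\<lambda>x. S x $$ (i, j)) differentiable at a"
  shows "(\<lambda>x. det (S x)) differentiable at a"
  unfolding det_def'[OF S]
  by (intro differentiable_sum ballI differentiable_mult differentiable_const differentiable_prod diff)
    (auto simp: finite_permutations permutes_in_image)

text \<open>Entries of the adjugate are signed minors, so this reduces to determinants of
  submatrices.\<close>

lemma differentiable_adj_mat:
  fixes S :: "'a::real_normed_vector \<Rightarrow> real mat"
  assumes S: "\<And>x. S x \<in> carrier_mat n n"
    and diff: "\<And>i j. i < n \<Longrightarrow> j < n \<Longrightarrow> (\<lambda>x. S x $$ (i, j)) differentiable at a"
    and ij: "i < n" "j < n"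
  shows "(\<lambda>x. adj_mat (S x) $$ (i, j)) differentiable at a"
proof -
  have "(\<lambda>x. det (mat_delete (S x) j i)) differentiable at a"
  proof (rule differentiable_det[where n = "n - 1"])
    show "mat_delete (S x) j i \<in> carrier_mat (n - 1) (n - 1)" for x
      by (rule mat_delete_carrier[OF S])
    fix k l assume kl: "k < n - 1" "l < n - 1"
    have "mat_delete (S x) j i $$ (k, l) =
        S x $$ (if k < j then k else Suc k, if l < i then l else Suc l)" for x
      using S[of x] kl by (auto simp: mat_delete_def)
    then show "(\<lambda>x. mat_delete (S x) j i $$ (k, l)) differentiable at a"
      using kl by (auto intro!: diff)
  qed
  moreover have "adj_mat (S x) $$ (i, j) = (- 1) ^ (j + i) * det (mat_delete (S x) j i)" for x
    using S[of x] ij by (simp add: adj_mat_def cofactor_def)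
  ultimately show ?thesis
    by (simp add: differentiable_mult)
qed

lemma differentiable_trace_lyapunov_sol:
  fixes A :: "'a::real_normed_vector \<Rightarrow> real mat"
  assumes A: "\<And>x. A x \<in> carrier_mat m m" and Z: "Z \<in> carrier_mat m m"
    and diff: "\<And>i j. i < m \<Longrightarrow> j < m \<Longrightarrow> (\<lambda>x. A x $$ (i, j)) differentiable at a"
    and stable: "stable_mat (A a)"
  shows "(\<lambda>x. mat_trace (lyapunov_sol (A x) Z)) differentiable at a"
proof -
  let ?S = "\<lambda>x. lyapunov_mat m (A x)"
  have diff_S: "(\<lambda>x. ?S x $$ (p, q)) differentiable at a" if "p < m * m" "q < m * m" for p q
  proof -
    have "(\<lambda>x. if c then A x $$ (i, j) else 0) differentiable at a"
      if "i < m" "j < m" for c i j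
      using that by (cases c) (auto intro: diff)
    then show ?thesis
      using that by (simp add: lyapunov_mat_def differentiable_add div_mod_less_square)
  qed
  note diff_det = differentiable_det[OF lyapunov_mat_carrier diff_S]
  note diff_adj = differentiable_adj_mat[OF lyapunov_mat_carrier diff_S]
  have det_a: "det (?S a) \<noteq> 0"
    by (rule det_lyapunov_mat_nonzero[OF A stable])
  \<comment> \<open>\<open>F\<close> is the trace read off from Cramer's rule;
    \<open>i + i * m\<close> is the vectorized position of the diagonal entry
    \<open>(i, i)\<close>.\<close>
  define F where "F x = (\<Sum>i<m. 1 / det (?S x) *
      (\<Sum>q<m * m. adj_mat (?S x) $$ (i + i * m, q) * vec_index (vectorize m (- Z)) q))" for x
  have trace_eq: "mat_trace (lyapunov_sol (A x) Z) = F x" if "det (?S x) \<noteq> 0" for x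
    using that adj_mat(1)[OF lyapunov_mat_carrier, of m "A x"]
    by (simp add: lyapunov_sol_Cramer[OF A Z] mat_trace_def unvectorize_def F_def scalar_prod_def
        add_mult_less_square atLeast0LessThan carrier_vecD[OF vectorize_carrier])
  have "F differentiable at a"
    unfolding F_def
    by (intro differentiable_sum ballI differentiable_mult differentiable_divide differentiable_const
        diff_det diff_adj det_a) (auto simp: add_mult_less_square)
  then obtain F' where F': "(F has_derivative F') (at a)"
    unfolding differentiable_def by blast
  \<comment> \<open>By continuity the determinant stays nonzero near \<open>a\<close>, so
    \<open>F\<close> agrees with the trace there. The filter \<open>at a\<close> omits
    \<open>a\<close> itself, where the equality is supplied separately by
    \<open>det_a\<close>.\<close>
  have "\<forall>\<^sub>F x in at a. det (?S x) \<noteq> 0"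
    using differentiable_imp_continuous_within[OF diff_det] det_a
    by (auto simp: continuous_within intro: tendsto_imp_eventually_ne)
  then have "\<forall>\<^sub>F x in at a. F x = mat_trace (lyapunov_sol (A x) Z)"
    by eventually_elim (simp add: trace_eq)
  from has_derivative_transform_eventually[OF F' this] trace_eq[OF det_a]
  show ?thesis
    unfolding differentiable_def by auto
qed

lemma differentiable_imp_GDERIV:
  fixes f :: "'a::euclidean_space \<Rightarrow> real"
  assumes "f differentiable at x"
  obtains g where "GDERIV f x :> g"
proof -
  from assms obtain f' where f': "(f has_derivative f') (at x)"
    unfolding differentiable_def by blast
  \<comment> \<open>Riesz representation: on the reals the inner product is multiplication, so
    \<open>f' h\<close> is the inner product of \<open>f' h\<close> with \<open>1\<close>, and the
    adjoint moves \<open>f'\<close> to the other side.\<close>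
  have "f' = (\<lambda>h. inner h (adjoint f' 1))"
    using adjoint_works[OF has_derivative_linear[OF f'], of _ 1] by auto
  with f' show ?thesis
    using that unfolding gderiv_def by metis
qed

text \<open>The parameter enters the system matrix affinely, through the lower right block, so all
  entries are differentiable.\<close>

lemma objective_differentiable:
  fixes D :: "'k::finite \<Rightarrow> real mat" and \<nu> :: "real ^ 'k"
  assumes Dint: "Dint \<in> carrier_mat n n" and \<Phi>: "\<Phi> \<in> carrier_mat n n" and s: "s \<le> n"
    and stable: "stable_mat (system_mat n \<Phi> \<omega> Dint D \<nu>)"
  shows "objective n s \<Phi> \<omega> Dint D differentiable at \<nu>"
  unfolding objective_def
proof (rule differentiable_trace_lyapunov_sol[where m = "n + n" and A = "system_mat n \<Phi> \<omega> Dint D" and a = \<nu>,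
      OF _ _ _ stable])
  have damp: "damping_mat n Dint D x \<in> carrier_mat n n" for x
    using Dint by (simp add: damping_mat_def)
  then have prod: "transpose_mat \<Phi> * damping_mat n Dint D x * \<Phi> \<in> carrier_mat n n" for x
    using \<Phi> by (intro mult_carrier_mat[of _ n n]) auto
  then show "system_mat n \<Phi> \<omega> Dint D x \<in> carrier_mat (n + n) (n + n)" for x
    unfolding system_mat_def by (intro four_block_carrier_mat) auto
  have "(1\<^sub>m s :: real mat) @\<^sub>r 0\<^sub>m (n - s) s \<in> carrier_mat n s"
    using s carrier_append_rows[OF one_carrier_mat zero_carrier_mat, of s "n - s"] by simp
  then have "G_mat n s \<in> carrier_mat (n + n) (s + s)"
    unfolding G_mat_def Let_def by (intro four_block_carrier_mat)
  then show "Z_mat n s \<in> carrier_mat (n + n) (n + n)"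
    by (auto simp: Z_mat_def)
  have diff_damp: "(\<lambda>x. damping_mat n Dint D x $$ (i, j)) differentiable at \<nu>"
    if "i < n" "j < n" for i j
  proof -
    have "damping_mat n Dint D x $$ (i, j) =
        Dint $$ (i, j) + (\<Sum>l\<in>UNIV. x $ l * (D l * transpose_mat (D l)) $$ (i, j))" for x
      using that Dint by (simp add: damping_mat_def)
    moreover have "(\<lambda>x. x $ l) differentiable at \<nu>" for l
      by (intro bounded_linear_imp_differentiable bounded_linear_vec_nth)
    ultimately show ?thesis
      by (simp add: differentiable_mult differentiable_sum differentiable_add)
  qed
  have diff_prod: "(\<lambda>x. (transpose_mat \<Phi> * damping_mat n Dint D x * \<Phi>) $$ (i, j)) differentiable at \<nu>"
    if ij: "i < n" "j < n" for i j
  proof -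
    have "(transpose_mat \<Phi> * damping_mat n Dint D x * \<Phi>) $$ (i, j) =
        (\<Sum>k<n. \<Phi> $$ (k, i) * (\<Sum>l<n. damping_mat n Dint D x $$ (k, l) * \<Phi> $$ (l, j)))" for x
      using ij \<Phi> damp[of x] by (simp add: scalar_prod_def atLeast0LessThan)
    then show ?thesis
      by (auto intro!: differentiable_mult differentiable_sum diff_damp)
  qed
  show "(\<lambda>x. system_mat n \<Phi> \<omega> Dint D x $$ (i, j)) differentiable at \<nu>"
    if ij: "i < n + n" "j < n + n" for i j
  proof (cases "i < n \<or> j < n")
    case True
    \<comment> \<open>Outside the lower right block the entry is the same for every parameter;
      evaluation at \<open>0\<close> merely names that constant.\<close>
    define c where "c = system_mat n \<Phi> \<omega> Dint D 0 $$ (i, j)"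
    have "system_mat n \<Phi> \<omega> Dint D x $$ (i, j) = c" for x
      using True ij \<Phi> by (auto simp: c_def system_mat_def)
    then show ?thesis by simp
  next
    case False
    have "system_mat n \<Phi> \<omega> Dint D x $$ (i, j) =
        - (transpose_mat \<Phi> * damping_mat n Dint D x * \<Phi>) $$ (i - n, j - n)" for x
      using False ij prod[of x] by (simp add: system_mat_def del: index_mult_mat)
    then show ?thesis
      using False ij diff_prod[of "i - n" "j - n"] by (simp add: differentiable_minus)
  qed
qed

section \<open>Elimination of the multiplier and componentwise complementarity\<close>

lemma KKT_iff_residual_eq_zero:
  fixes f :: "real ^ 'k::finite \<Rightarrow> real"
  assumes g: "GDERIV f \<nu> :> g"
  shows "(\<exists>\<mu>. KKT f \<nu> \<mu>) \<longleftrightarrow> residual f \<nu> = 0"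
proof -
  have L: "GDERIV (\<lambda>x. lagrangian f x \<mu>) \<nu> :> g - \<mu>" for \<mu>
  proof -
    have "GDERIV (\<lambda>x. inner x \<mu>) \<nu> :> \<mu>"
      unfolding gderiv_def by (intro derivative_intros)
    with g show ?thesis
      unfolding lagrangian_def by (rule GDERIV_diff)
  qed
  \<comment> \<open>Gradients are unique, so \<open>g - \<mu>\<close> being a gradient forces it to
    equal \<open>0\<close> whenever \<open>0\<close> is one.\<close>
  then have stationary: "GDERIV (\<lambda>x. lagrangian f x \<mu>) \<nu> :> 0 \<longleftrightarrow> \<mu> = g" for \<mu>
    by (metis eq_iff_diff_eq_0 gradient_eqI)
  have "(\<exists>\<mu>. KKT f \<nu> \<mu>) \<longleftrightarrow> 0 \<le> \<nu> \<and> 0 \<le> g \<and> inner \<nu> g = 0"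
    unfolding KKT_def stationary by auto
  \<comment> \<open>A sum of nonnegative products vanishes only if every product does, so
    orthogonality splits into components.\<close>
  also have "\<dots> \<longleftrightarrow> (\<forall>i. 0 \<le> \<nu> $ i \<and> 0 \<le> g $ i \<and> \<nu> $ i * g $ i = 0)"
    by (auto simp: Finite_Cartesian_Product.less_eq_vec_def inner_vec_def sum_nonneg_eq_0_iff)
  \<comment> \<open>If the maximum is the first argument, the gradient component is zero and that of
    \<open>\<nu>\<close> nonnegative; if it is \<open>0\<close>, the component of
    \<open>\<nu>\<close> is zero and that of the gradient nonnegative.\<close>
  also have "\<dots> \<longleftrightarrow> (\<forall>i. \<nu> $ i = max (\<nu> $ i - g $ i) 0)"
    by (intro all_cong1) (auto simp: max_def)
  also have "\<dots> \<longleftrightarrow> residual f \<nu> = 0"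
    by (simp add: residual_def gradient_eqI[OF g] vmax_def Finite_Cartesian_Product.vec_eq_iff)
  finally show ?thesis .
qed

theorem mainTheorem4:
  fixes n s :: nat
    and M K Dint \<Phi> :: "real mat"
    and \<omega> :: "nat \<Rightarrow> real"
    and r :: "'k::finite \<Rightarrow> nat"
    and D :: "'k \<Rightarrow> real mat"
    and \<nu> :: "real ^ 'k"
  assumes "spd_mat n M"
    and "spd_mat n K"
    and "spsd_mat n Dint"
    and "Dint * the (mat_inverse M) * K = K * the (mat_inverse M) * Dint"
    and "\<And>i. D i \<in> carrier_mat n (r i)"
    and "\<And>i. full_rank_mat (D i)"
    and "\<Phi> \<in> carrier_mat n n"
    and "invertible_mat \<Phi>"
    and "transpose_mat \<Phi> * M * \<Phi> = 1\<^sub>m n"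
    and "transpose_mat \<Phi> * K * \<Phi> = mat_diag n \<omega> ^\<^sub>m 2"
    and "\<And>j. j < n \<Longrightarrow> \<omega> j > 0"
    and "diagonal_mat (transpose_mat \<Phi> * Dint * \<Phi>)"
    and "1 \<le> s" and "s \<le> n"
    and "stable_mat (system_mat n \<Phi> \<omega> Dint D \<nu>)"
  shows "(\<exists>\<mu>. KKT (objective n s \<Phi> \<omega> Dint D) \<nu> \<mu>)
     \<longleftrightarrow> residual (objective n s \<Phi> \<omega> Dint D) \<nu> = 0"
proof -
  have "Dint \<in> carrier_mat n n"
    using \<open>spsd_mat n Dint\<close> by (simp add: spsd_mat_def)
  from objective_differentiable[OF this \<open>\<Phi> \<in> carrier_mat n n\<close> \<open>s \<le> n\<close>
      \<open>stable_mat (system_mat n \<Phi> \<omega> Dint D \<nu>)\<close>]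
  obtain g where "GDERIV (objective n s \<Phi> \<omega> Dint D) \<nu> :> g"
    by (rule differentiable_imp_GDERIV)
  then show ?thesis
    by (rule KKT_iff_residual_eq_zero)
qed

end
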